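(* Let $N\ge 1$, let $T:\mathbb{R}_+^N\to\mathbb{R}_{++}^N$ be a continuous concave mapping with lower bounding matrix $M\in\mathbb{R}_+^{N\times N}$, let $\rho(M)$ denote the spectral radius of $M$, and let $\|\cdot\|_a$ and $\|\cdot\|_b$ be monotone norms on $\mathbb{R}^N$. Let $E:\mathbb{R}_{++}\to\mathbb{R}_{++}$ be the $\|\cdot\|_b$-energy efficiency function associated with the canonical utility maximization problem for $T$ and $\|\cdot\|_a$. Then: (i) The limit $\lim_{\bar p\to\infty}E(\bar p)$ exists and $\inf_{\bar p>0}E(\bar p)=\lim_{\bar p\to\infty}E(\bar p)<\infty$. Furthermore, if $\rho(M)>0$, then $\lim_{\bar p\to\infty}E(\bar p)=0$. (ii) Assume that $\rho(M)>0$. Then $$(\exists k_1\in\mathbb{R}_{++})(\exists k_2\in\mathbb{R}_{++})(\forall\bar p\in\mathbb{R}_{++})\quad \frac{1}{k_1\bar p+k_2}\le E(\bar p).$$ (iii) Assume that $\rho(M)>0$. Then $E(\bar p)\in\Theta(1/\bar p)$ as $\bar p\to\infty$.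
   Context: Notation: $\mathbb{R}_+=[0,\infty)$, $\mathbb{R}_{++}=(0,\infty)$; vector inequalities are entrywise; $e_j$ is the $j$th standard basis vector of $\mathbb{R}^N$. A mapping $T:\mathbb{R}_+^N\to\mathbb{R}^N$ is concave if $T(\alpha x+(1-\alpha)y)\ge \alpha T(x)+(1-\alpha)T(y)$ for all $x,y\in\mathbb{R}_+^N$, $\alpha\in(0,1)$. A norm $\|\cdot\|$ on $\mathbb{R}^N$ is monotone if for all $x,y\in\mathbb{R}_+^N$, $x\ge y$ implies $\|x\|\ge\|y\|$. Canonical utility maximization problem: given a power budget $\bar p\in\mathbb{R}_{++}$, maximize $c$ over $(p,c)\in\mathbb{R}_+^N\times\mathbb{R}_{++}$ subject to $p=cT(p)$ and $\|p\|_a\le\bar p$. It is known that for every $\bar p>0$ this problem has a unique solution $(p^\star_{\bar p},c^\star_{\bar p})\in\mathbb{R}_{++}^N\times\mathbb{R}_{++}$, and that it is also the unique pair satisfying $T(p)=\frac1c p$ and $\|p\|_a=\bar p$. The utility function is $U:\mathbb{R}_{++}\to\mathbb{R}_{++}$, $U(\bar p)=c^\star_{\bar p}$, and the power function is $P:\mathbb{R}_{++}\to\mathbb{R}_{++}^N$, $P(\bar p)=p^\star_{\bar p}$. The $\|\cdot\|_b$-energy efficiency function is $E:\mathbb{R}_{++}\to\mathbb{R}_{++}$, $E(\bar p)=U(\bar p)/\|P(\bar p)\|_b$ (equivalently $1/\|T(P(\bar p))\|_b$). Lower bounding matrix: for a continuous concave $T=[t_1,\ldots,t_N]:\mathbb{R}_+^N\to\mathbb{R}_{++}^N$,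 it is the matrix $M\in\mathbb{R}_+^{N\times N}$ with entries $[M]_{i,j}=\lim_{h\to0^+}h\,t_i(h^{-1}e_j)$ (the limits exist and are finite and non-negative). Theta notation: $f(x)\in\Theta(g(x))$ as $x\to\infty$ means that there exist $k_0,k_1,k_2\in\mathbb{R}_{++}$ such that $k_1g(x)\le f(x)\le k_2g(x)$ for all $x\ge k_0$. *)

theory Defs
  imports "HOL-Analysis.Analysis"
begin

(* On real ^ 'n the order \<le> is entrywise, so {0..} is the nonnegative orthant.  The
   associated < is not entrywise strict, hence strict positivity is written by components. *)

definition concave_map :: "(real ^ 'n \<Rightarrow> real ^ 'n) \<Rightarrow> bool" where
  "concave_map T \<longleftrightarrow>
     (\<forall>x\<in>{0..}. \<forall>y\<in>{0..}. \<forall>\<alpha>\<in>{0<..<1}.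
        T (\<alpha> *\<^sub>R x + (1 - \<alpha>) *\<^sub>R y) \<ge> \<alpha> *\<^sub>R T x + (1 - \<alpha>) *\<^sub>R T y)"

definition is_norm :: "('a :: real_vector \<Rightarrow> real) \<Rightarrow> bool" where
  "is_norm \<nu> \<longleftrightarrow>
     (\<forall>x. \<nu> x \<ge> 0) \<and> (\<forall>x. \<nu> x = 0 \<longleftrightarrow> x = 0) \<and>
     (\<forall>a x. \<nu> (a *\<^sub>R x) = \<bar>a\<bar> * \<nu> x) \<and> (\<forall>x y. \<nu> (x + y) \<le> \<nu> x + \<nu> y)"

definition monotone_norm :: "(real ^ 'n \<Rightarrow> real) \<Rightarrow> bool" where
  "monotone_norm \<nu> \<longleftrightarrow> is_norm \<nu> \<and> (\<forall>x\<in>{0..}. \<forall>y\<in>{0..}. x \<ge> y \<longrightarrow> \<nu> x \<ge> \<nu> y)"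

definition lower_bounding_matrix :: "(real ^ 'n \<Rightarrow> real ^ 'n) \<Rightarrow> real ^ 'n ^ 'n" where
  "lower_bounding_matrix T =
     (\<chi> i j. Lim (at_right 0) (\<lambda>h. h * T (inverse h *\<^sub>R axis j 1) $ i))"

definition complex_eigenvalues :: "real ^ 'n ^ 'n \<Rightarrow> complex set" where
  "complex_eigenvalues A =
     {k. \<exists>v :: complex ^ 'n. v \<noteq> 0 \<and> (\<chi> i j. complex_of_real (A $ i $ j)) *v v = k *s v}"

definition matrix_spectral_radius :: "real ^ 'n ^ 'n \<Rightarrow> real" where
  "matrix_spectral_radius A = Max (norm ` complex_eigenvalues A)"

definition feasible_pair ::
  "(real ^ 'n \<Rightarrow> real ^ 'n) \<Rightarrow> (real ^ 'n \<Rightarrow> real) \<Rightarrow> real \<Rightarrow> (real ^ 'n) \<times> real \<Rightarrow> bool" where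
  "feasible_pair T \<nu> b = (\<lambda>(p, c). 0 \<le> p \<and> 0 < c \<and> p = c *\<^sub>R T p \<and> \<nu> p \<le> b)"

definition optimal_pair ::
  "(real ^ 'n \<Rightarrow> real ^ 'n) \<Rightarrow> (real ^ 'n \<Rightarrow> real) \<Rightarrow> real \<Rightarrow> (real ^ 'n) \<times> real" where
  "optimal_pair T \<nu> b = (THE pc. is_arg_max snd (feasible_pair T \<nu> b) pc)"

definition utility_function ::
  "(real ^ 'n \<Rightarrow> real ^ 'n) \<Rightarrow> (real ^ 'n \<Rightarrow> real) \<Rightarrow> real \<Rightarrow> real" where
  "utility_function T \<nu> b = snd (optimal_pair T \<nu> b)"

definition power_function ::
  "(real ^ 'n \<Rightarrow> real ^ 'n) \<Rightarrow> (real ^ 'n \<Rightarrow> real) \<Rightarrow> real \<Rightarrow> real ^ 'n" where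
  "power_function T \<nu> b = fst (optimal_pair T \<nu> b)"

definition energy_efficiency ::
  "(real ^ 'n \<Rightarrow> real ^ 'n) \<Rightarrow> (real ^ 'n \<Rightarrow> real) \<Rightarrow> (real ^ 'n \<Rightarrow> real) \<Rightarrow> real \<Rightarrow> real" where
  "energy_efficiency T \<nu>a \<nu>b b = utility_function T \<nu>a b / \<nu>b (power_function T \<nu>a b)"

(* Unlike the library's Landau symbol, this bounds f itself and not its absolute value. *)
definition theta_at_infinity :: "(real \<Rightarrow> real) \<Rightarrow> (real \<Rightarrow> real) set" where
  "theta_at_infinity g =
     {f. \<exists>k0>0. \<exists>k1>0. \<exists>k2>0. \<forall>x\<ge>k0. k1 * g x \<le> f x \<and> f x \<le> k2 * g x}"

end

theory Submission
  imports Defs "HOL-Computational_Algebra.Fundamental_Theorem_Algebra"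
begin

text \<open>Concavity and positivity make \<open>T\<close> monotone and strictly subhomogeneous, so solutions of
  \<open>p = c T(p)\<close> increase with \<open>c\<close>; together with Brouwer's theorem this makes the optimal pair the
  unique solution with \<open>p\<close> on the sphere of radius \<open>b\<close>. Then \<open>E b = 1 / norm_b (T p)\<close> decreases,
  and as \<open>norm_b (T p)\<close> grows at most linearly in \<open>norm_a p = b\<close>, \<open>E\<close> is bounded from below. For the
  bound from above, \<open>p = c T(p) \<ge> c M p\<close> with \<open>p\<close> positive forces \<open>c \<rho>(M) \<le> 1\<close>, and
  \<open>E b = c / norm_b p\<close>.\<close>

subsection \<open>Norms\<close>

lemma is_norm_nonneg: "is_norm \<nu> \<Longrightarrow> \<nu> x \<ge> 0"
  and is_norm_eq_0_iff: "is_norm \<nu> \<Longrightarrow> \<nu> x = 0 \<longleftrightarrow> x = 0"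
  and is_norm_scaleR: "is_norm \<nu> \<Longrightarrow> \<nu> (a *\<^sub>R x) = \<bar>a\<bar> * \<nu> x"
  and is_norm_triangle: "is_norm \<nu> \<Longrightarrow> \<nu> (x + y) \<le> \<nu> x + \<nu> y"
  by (auto simp: is_norm_def)

lemma is_norm_pos: "is_norm \<nu> \<Longrightarrow> x \<noteq> 0 \<Longrightarrow> \<nu> x > 0"
  by (metis is_norm_nonneg is_norm_eq_0_iff less_eq_real_def)

lemma is_norm_zero: "is_norm \<nu> \<Longrightarrow> \<nu> 0 = 0"
  by (simp add: is_norm_eq_0_iff)

lemma convex_on_is_norm:
  assumes "is_norm \<nu>" "convex S"
  shows "convex_on S \<nu>"
proof (rule convex_onI)
  fix t x y assume "0 < t" "t < (1::real)"
  then show "\<nu> ((1 - t) *\<^sub>R x + t *\<^sub>R y) \<le> (1 - t) * \<nu> x + t * \<nu> y"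
    using is_norm_triangle[OF assms(1), of "(1 - t) *\<^sub>R x" "t *\<^sub>R y"]
    by (simp add: is_norm_scaleR[OF assms(1)])
qed (use assms in auto)

text \<open>A norm is convex, and a convex function on a whole finite-dimensional space is
  continuous.\<close>

lemma continuous_on_is_norm:
  fixes \<nu> :: "'a :: euclidean_space \<Rightarrow> real"
  assumes "is_norm \<nu>"
  shows "continuous_on S \<nu>"
  using convex_on_continuous[OF open_UNIV convex_on_is_norm[OF assms convex_UNIV]]
  by (rule continuous_on_subset) auto

text \<open>By compactness \<open>\<nu>\<close> attains a minimum on the Euclidean unit sphere. It
  is positive because its minimiser is nonzero, and homogeneity carries the bound to every
  \<open>x\<close>.\<close>

lemma is_norm_lower_bound:
  fixes \<nu> :: "'a :: euclidean_space \<Rightarrow> real"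
  assumes "is_norm \<nu>"
  obtains m where "m > 0" "\<And>x. m * norm x \<le> \<nu> x"
proof -
  obtain u :: 'a where "u \<in> sphere 0 1" "\<And>y. y \<in> sphere 0 1 \<Longrightarrow> \<nu> u \<le> \<nu> y"
    using continuous_attains_inf[OF compact_sphere _ continuous_on_is_norm[OF assms], of 0 1]
    by (auto simp: sphere_eq_empty)
  note u = this
  show thesis
  proof
    show "\<nu> u > 0" using u(1) by (intro is_norm_pos[OF assms]) auto
    show "\<nu> u * norm x \<le> \<nu> x" for x
    proof (cases "x = 0")
      case False
      then have "\<nu> u \<le> \<nu> (inverse (norm x) *\<^sub>R x)" by (intro u) simp
      then show ?thesis using False by (simp add: is_norm_scaleR[OF assms] field_simps)
    qed (simp add: is_norm_nonneg[OF assms])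
  qed
qed

lemma is_norm_upper_bound:
  fixes \<nu> :: "'a :: euclidean_space \<Rightarrow> real"
  assumes "is_norm \<nu>"
  obtains m where "m > 0" "\<And>x. \<nu> x \<le> m * norm x"
proof -
  obtain u :: 'a where "u \<in> sphere 0 1" "\<And>y. y \<in> sphere 0 1 \<Longrightarrow> \<nu> y \<le> \<nu> u"
    using continuous_attains_sup[OF compact_sphere _ continuous_on_is_norm[OF assms], of 0 1]
    by (auto simp: sphere_eq_empty)
  note u = this
  show thesis
  proof
    show "\<nu> u > 0" using u(1) by (intro is_norm_pos[OF assms]) auto
    show "\<nu> x \<le> \<nu> u * norm x" for x
    proof (cases "x = 0")
      case False
      then have "\<nu> (inverse (norm x) *\<^sub>R x) \<le> \<nu> u" by (intro u) simp
      then show ?thesis using False by (simp add: is_norm_scaleR[OF assms] field_simps)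
    qed (simp add: is_norm_zero[OF assms])
  qed
qed

lemma is_norm_equivalent:
  fixes \<mu> \<nu> :: "'a :: euclidean_space \<Rightarrow> real"
  assumes "is_norm \<mu>" "is_norm \<nu>"
  obtains m where "m > 0" "\<And>x. m * \<mu> x \<le> \<nu> x"
proof -
  obtain k where k: "k > 0" "\<And>x. k * norm x \<le> \<nu> x" using is_norm_lower_bound[OF assms(2)] by blast
  obtain l where l: "l > 0" "\<And>x. \<mu> x \<le> l * norm x" using is_norm_upper_bound[OF assms(1)] by blast
  show thesis
  proof
    show "k / l > 0" using k l by simp
    show "k / l * \<mu> x \<le> \<nu> x" for x
    proof -
      have "k / l * \<mu> x \<le> k / l * (l * norm x)"
        using k(1) l by (intro mult_left_mono) auto
      also have "\<dots> \<le> \<nu> x" using k l(1) by simp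
      finally show ?thesis .
    qed
  qed
qed

text \<open>Together with the convexity proved next, this provides the domain for Brouwer's
  theorem.\<close>

lemma compact_nonneg_norm_ball:
  fixes \<nu> :: "real ^ 'n \<Rightarrow> real"
  assumes "is_norm \<nu>"
  shows "compact {x. 0 \<le> x \<and> \<nu> x \<le> b}"
proof -
  obtain k where k: "k > 0" "\<And>x. k * norm x \<le> \<nu> x" using is_norm_lower_bound[OF assms] by blast
  have "{x. 0 \<le> x \<and> \<nu> x \<le> b} = {0..} \<inter> {x. \<nu> x \<le> b}" by auto
  moreover have "closed ({0..} :: (real ^ 'n) set)" by (rule closed_eucl_atLeast)
  moreover have "closed {x. \<nu> x \<le> b}"
    by (intro closed_Collect_le continuous_on_is_norm[OF assms] continuous_on_const)
  moreover have "bounded {x. 0 \<le> x \<and> \<nu> x \<le> b}"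
  proof (rule boundedI)
    fix x assume "x \<in> {x. 0 \<le> x \<and> \<nu> x \<le> b}"
    then have "k * norm x \<le> b" using k(2)[of x] by auto
    then show "norm x \<le> b / k" using k(1) by (simp add: field_simps)
  qed
  ultimately show ?thesis by (simp add: compact_eq_bounded_closed closed_Int)
qed

lemma convex_nonneg_norm_ball:
  fixes \<nu> :: "real ^ 'n \<Rightarrow> real"
  assumes "is_norm \<nu>"
  shows "convex {x. 0 \<le> x \<and> \<nu> x \<le> b}"
proof -
  have "\<nu> (u *\<^sub>R x + v *\<^sub>R y) \<le> b"
    if "\<nu> x \<le> b" "\<nu> y \<le> b" "0 \<le> u" "0 \<le> v" "u + v = 1" for x y u v
  proof -
    have "\<nu> (u *\<^sub>R x + v *\<^sub>R y) \<le> u * \<nu> x + v * \<nu> y"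
      using is_norm_triangle[OF assms, of "u *\<^sub>R x" "v *\<^sub>R y"] that
      by (simp add: is_norm_scaleR[OF assms])
    also have "\<dots> \<le> b" using that by (intro convex_bound_le)
    finally show ?thesis .
  qed
  then show ?thesis by (auto simp: convex_def less_eq_vec_def)
qed

subsection \<open>Eigenvalues\<close>

text \<open>Lets the characteristic polynomial be written as a determinant over the polynomial ring:
  evaluation at \<open>z\<close> respects the sums and products in \<open>det\<close>.\<close>

lemma poly_det:
  fixes B :: "complex poly ^ 'n ^ 'n"
  shows "poly (det B) z = det (\<chi> i j. poly (B $ i $ j) z)"
  by (simp add: det_def poly_sum poly_prod)

lemma det_scale:
  fixes B :: "complex ^ 'n ^ 'n"
  shows "det (\<chi> i j. z * B $ i $ j) = z ^ CARD('n) * det B"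
  by (simp add: det_def prod.distrib sum_distrib_left mult_ac)

lemma eigenvalue_iff_det:
  fixes B :: "complex ^ 'n ^ 'n"
  shows "(\<exists>v. v \<noteq> 0 \<and> B *v v = k *s v) \<longleftrightarrow> det (B - mat k) = 0"
proof -
  have "(B - mat k) *v v = B *v v - k *s v" for v
    by (simp add: vec_eq_iff matrix_vector_mult_def mat_def left_diff_distrib sum_subtractf
        if_distrib[of "\<lambda>x. x * _"] cong: if_cong)
  then have "(\<exists>v. v \<noteq> 0 \<and> B *v v = k *s v) \<longleftrightarrow> \<not> (\<forall>v. (B - mat k) *v v = 0 \<longrightarrow> v = 0)"
    by auto
  also have "\<dots> \<longleftrightarrow> \<not> invertible (B - mat k)"
    by (simp add: invertible_left_inverse matrix_left_invertible_ker)
  also have "\<dots> \<longleftrightarrow> det (B - mat k) = 0" by (simp add: invertible_det_nz)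
  finally show ?thesis .
qed

text \<open>The reversed polynomial \<open>det (z B - 1)\<close> does not vanish at 0, which replaces the computation of
  the leading coefficient of the characteristic polynomial.\<close>

lemma eigenvalues_finite_nonempty:
  fixes B :: "complex ^ 'n ^ 'n"
  defines "S \<equiv> {k. \<exists>v. v \<noteq> 0 \<and> B *v v = k *s v}"
  shows "finite S" "S \<noteq> {}"
proof -
  define P :: "complex poly" where "P = det (\<chi> i j. [: B $ i $ j :] - (if i = j then [:0, 1:] else 0))"
  define Q :: "complex poly" where "Q = det (\<chi> i j. [: 0, B $ i $ j :] - (if i = j then 1 else 0))"
  have S: "S = {k. poly P k = 0}"
    unfolding S_def eigenvalue_iff_det P_def poly_det
    by (rule Collect_cong) (simp add: mat_def if_distrib[of "\<lambda>p. poly p _"] cong: if_cong,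
      intro arg_cong[of _ _ "\<lambda>A. det A = 0"], simp add: vec_eq_iff)
  have Q0: "poly Q 0 \<noteq> 0"
  proof -
    have "poly Q 0 = det (\<chi> i j. - 1 * (mat 1 :: complex ^ 'n ^ 'n) $ i $ j)"
      unfolding Q_def poly_det by (intro arg_cong[of _ _ det]) (simp add: vec_eq_iff mat_def)
    also have "\<dots> = (- 1) ^ CARD('n) * det (mat 1 :: complex ^ 'n ^ 'n)" by (rule det_scale)
    finally show ?thesis by simp
  qed
  \<comment> \<open>Pulling a factor \<open>z\<close> out of each row: \<open>det (z B - 1)\<close>
    equals \<open>z ^ n\<close> times \<open>det (B - 1 / z)\<close>, with \<open>n\<close> the
    dimension.\<close>
  have PQ: "poly Q z = z ^ CARD('n) * poly P (1 / z)" if "z \<noteq> 0" for z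
    unfolding P_def Q_def poly_det det_scale[symmetric] using that
    by (intro arg_cong[of _ _ det]) (simp add: vec_eq_iff field_simps)
  \<comment> \<open>If \<open>P\<close> were the constant \<open>d\<close>, then \<open>Q\<close>
    would agree with \<open>d z ^ n\<close> off 0, hence identically. The monomial vanishes at 0
    because \<open>n\<close> is positive, contradicting \<open>Q0\<close>.\<close>
  have nonconst: "\<not> (\<forall>z. poly P z = d)" for d
  proof
    assume "\<forall>z. poly P z = d"
    then have "poly (Q - monom d CARD('n)) z = 0" if "z \<noteq> 0" for z
      using PQ[OF that] by (simp add: poly_monom)
    then have "- {0} \<subseteq> {z. poly (Q - monom d CARD('n)) z = 0}" by auto
    moreover have "infinite (- {0 :: complex})"
      by (simp add: infinite_UNIV_char_0 Compl_eq_Diff_UNIV)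
    ultimately have "Q - monom d CARD('n) = 0"
      using poly_roots_finite finite_subset by blast
    then have "poly (monom d CARD('n)) 0 \<noteq> 0" using Q0 by simp
    then show False by (simp add: poly_monom)
  qed
  have "P \<noteq> 0" using nonconst[of 0] by auto
  then show "finite S" unfolding S by (rule poly_roots_finite)
  show "S \<noteq> {}"
  proof -
    have "\<not> constant (poly P)"
    proof
      assume "constant (poly P)"
      then have "\<forall>z. poly P z = poly P 0" unfolding constant_def by blast
      then show False using nonconst by blast
    qed
    then show ?thesis using fundamental_theorem_of_algebra[of P] unfolding S by auto
  qed
qed

text \<open>The \<open>Max\<close> in the definition is meaningful only for a finite nonempty set;
  both properties come from the preceding lemma.\<close>

lemma matrix_spectral_radius_attained:
  fixes A :: "real ^ 'n ^ 'n"
  obtains k where "k \<in> complex_eigenvalues A" "norm k = matrix_spectral_radius A"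
proof -
  have "matrix_spectral_radius A \<in> norm ` complex_eigenvalues A"
    using eigenvalues_finite_nonempty[of "\<chi> i j. complex_of_real (A $ i $ j)"]
    unfolding matrix_spectral_radius_def complex_eigenvalues_def by (intro Max_in) auto
  then show thesis using that by auto
qed

text \<open>Serves both the spectral radius bound and the comparison of two solutions:
  \<open>k\<close> is an index of largest ratio, and at \<open>k\<close> the inequality is an
  equality.\<close>

lemma vec_ratio_max:
  fixes x y :: "real ^ 'n"
  assumes "\<And>i. y $ i > 0"
  obtains k where "\<And>i. x $ i \<le> (x $ k / y $ k) * y $ i"
proof -
  have "\<exists>k. \<forall>i. x $ i / y $ i \<le> x $ k / y $ k"
    using Max_in[of "range (\<lambda>i. x $ i / y $ i)"] Max_ge[of "range (\<lambda>i. x $ i / y $ i)"]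
    by (metis (no_types, lifting) finite_class.finite_UNIV finite_imageI image_iff image_is_empty
        UNIV_not_empty rangeI)
  then obtain k where "\<And>i. x $ i / y $ i \<le> x $ k / y $ k" by auto
  then show thesis using assms that by (metis pos_divide_le_eq)
qed

text \<open>Compare an eigenvector \<open>v\<close> with \<open>p\<close> at an index maximising \<open>|v i| / p i\<close>
  (Collatz--Wielandt).\<close>

lemma spectral_radius_le:
  fixes A :: "real ^ 'n ^ 'n" and p :: "real ^ 'n"
  assumes nonneg: "\<And>i j. A $ i $ j \<ge> 0" and pos: "\<And>i. p $ i > 0"
    and sub: "\<And>i. (A *v p) $ i \<le> r * p $ i"
  shows "matrix_spectral_radius A \<le> r"
proof -
  obtain k where k: "k \<in> complex_eigenvalues A" "norm k = matrix_spectral_radius A"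
    by (rule matrix_spectral_radius_attained)
  then obtain v :: "complex ^ 'n" where v: "v \<noteq> 0"
    and eig: "(\<chi> i j. complex_of_real (A $ i $ j)) *v v = k *s v"
    by (auto simp: complex_eigenvalues_def)
  define u :: "real ^ 'n" where "u = (\<chi> i. norm (v $ i))"
  obtain l where l: "\<And>i. u $ i \<le> (u $ l / p $ l) * p $ i" using vec_ratio_max[OF pos] by blast
  \<comment> \<open>Otherwise the largest ratio is 0 and the whole eigenvector vanishes.\<close>
  have "u $ l > 0"
  proof (rule ccontr)
    assume "\<not> u $ l > 0"
    then have "u $ l = 0" by (simp add: u_def)
    then have "u $ i \<le> 0" for i using l[of i] by simp
    then show False using v by (simp add: u_def vec_eq_iff)
  qed
  have "norm k * u $ l = norm ((k *s v) $ l)" by (simp add: u_def norm_mult)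
  also have "\<dots> = norm (\<Sum>j\<in>UNIV. complex_of_real (A $ l $ j) * v $ j)"
    unfolding eig[symmetric] by (simp add: matrix_vector_mult_def)
  also have "\<dots> \<le> (\<Sum>j\<in>UNIV. A $ l $ j * u $ j)"
    by (intro sum_norm_le) (simp add: norm_mult u_def nonneg)
  also have "\<dots> \<le> (\<Sum>j\<in>UNIV. A $ l $ j * ((u $ l / p $ l) * p $ j))"
    by (intro sum_mono mult_left_mono l nonneg)
  also have "\<dots> = (u $ l / p $ l) * (A *v p) $ l"
    by (simp add: matrix_vector_mult_def sum_distrib_left mult_ac)
  also have "\<dots> \<le> (u $ l / p $ l) * (r * p $ l)"
    using \<open>u $ l > 0\<close> pos[of l] by (intro mult_left_mono sub) auto
  also have "\<dots> = r * u $ l" using pos[of l] by simp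
  finally show ?thesis using \<open>u $ l > 0\<close> k by simp
qed

subsection \<open>Positive concave mappings\<close>

locale positive_concave_map =
  fixes T :: "real ^ 'n \<Rightarrow> real ^ 'n"
  assumes pos: "\<And>x i. 0 \<le> x \<Longrightarrow> 0 < T x $ i"
    and concave: "concave_map T"
begin

lemma concaveD:
  assumes "0 \<le> x" "0 \<le> y" "0 < t" "t < 1"
  shows "t * T x $ i + (1 - t) * T y $ i \<le> T (t *\<^sub>R x + (1 - t) *\<^sub>R y) $ i"
  using concave assms by (simp add: concave_map_def less_eq_vec_def)

lemma nonneg: "0 \<le> x \<Longrightarrow> 0 \<le> T x"
  using pos by (simp add: less_eq_vec_def less_imp_le)

lemma nonzero: "0 \<le> x \<Longrightarrow> T x \<noteq> 0"
  using pos[of x] by (metis less_irrefl zero_index)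

text \<open>For \<open>t < 1\<close>, \<open>y\<close> is the combination of \<open>x\<close> and a nonnegative vector with weights
  \<open>t\<close> and \<open>1 - t\<close>; let \<open>t\<close> tend to 1.\<close>

lemma mono:
  assumes "0 \<le> x" "x \<le> y"
  shows "T x \<le> T y"
  unfolding less_eq_vec_def
proof (rule allI, rule field_le_mult_one_interval)
  fix i and t :: real assume t: "0 < t" "t < 1"
  define w where "w = inverse (1 - t) *\<^sub>R (y - t *\<^sub>R x)"
  have "t * x $ j \<le> y $ j" for j
  proof -
    have "t * x $ j \<le> 1 * x $ j"
      using assms(1) t by (intro mult_right_mono) (auto simp: less_eq_vec_def)
    also have "\<dots> \<le> y $ j" using assms(2) by (simp add: less_eq_vec_def)
    finally show ?thesis .
  qed
  then have w: "0 \<le> w" using t by (simp add: w_def less_eq_vec_def)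
  have y: "y = t *\<^sub>R x + (1 - t) *\<^sub>R w" using t by (simp add: w_def)
  have "t * T x $ i \<le> t * T x $ i + (1 - t) * T w $ i" using pos[OF w, of i] t by simp
  also have "\<dots> \<le> T y $ i" unfolding y by (rule concaveD[OF assms(1) w t])
  finally show "t * T x $ i \<le> T y $ i" .
qed

text \<open>Concavity on the segment from 0 to \<open>x\<close>; strictness comes from the positive
  term \<open>(1 - t) * T 0 $ i\<close>.\<close>

lemma scale_less:
  assumes "0 \<le> x" "0 < t" "t < 1"
  shows "t * T x $ i < T (t *\<^sub>R x) $ i"
proof -
  have "t * T x $ i < t * T x $ i + (1 - t) * T 0 $ i" using pos[of 0 i] assms by simp
  also have "\<dots> \<le> T (t *\<^sub>R x) $ i" using concaveD[OF assms(1) order_refl assms(2,3)] by simp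
  finally show ?thesis .
qed

lemma scale_le:
  assumes "0 \<le> x" "0 < t" "t \<le> 1"
  shows "t * T x $ i \<le> T (t *\<^sub>R x) $ i"
  using scale_less[OF assms(1,2), of i] assms(3) by (cases "t = 1") auto

section \<open>Solutions of \<open>p = c T(p)\<close>: comparison, existence and optimality\<close>

lemma solution_pos:
  assumes "0 \<le> p" "0 < c" "p = c *\<^sub>R T p"
  shows "0 < p $ i"
proof -
  have "p $ i = c * T p $ i" using assms(3) by (metis vector_scaleR_component real_scaleR_def)
  then show ?thesis using pos[OF assms(1)] assms(2) by simp
qed

text \<open>Let \<open>r\<close> be the largest ratio \<open>p i / q i\<close>, attained at
  \<open>k\<close>. If \<open>r > 1\<close>, monotonicity and strict subhomogeneity give
  \<open>T p $ k < r * T q $ k\<close>. Multiplying by \<open>c \<le> d\<close> and using both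
  equations yields \<open>p $ k < r * q $ k = p $ k\<close>.\<close>

lemma solution_mono:
  assumes p: "0 \<le> p" "p = c *\<^sub>R T p" and q: "0 \<le> q" "q = d *\<^sub>R T q" and cd: "0 < c" "c \<le> d"
  shows "p \<le> q"
proof -
  have d: "0 < d" using cd by simp
  note pp = solution_pos[OF p(1) cd(1) p(2)] and qp = solution_pos[OF q(1) d q(2)]
  obtain k where k: "\<And>i. p $ i \<le> (p $ k / q $ k) * q $ i" using vec_ratio_max[OF qp] by blast
  define r where "r = p $ k / q $ k"
  have r0: "0 < r" using pp qp by (simp add: r_def)
  have "r \<le> 1"
  proof (rule ccontr)
    assume "\<not> r \<le> 1"
    then have r1: "0 < 1 / r" "1 / r < 1" by auto
    have rq: "0 \<le> r *\<^sub>R q" using q(1) r0 by (simp add: less_eq_vec_def)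
    have "T p $ k \<le> T (r *\<^sub>R q) $ k"
      using mono[OF p(1), of "r *\<^sub>R q"] k by (simp add: less_eq_vec_def r_def)
    also have "\<dots> < r * T q $ k"
      using scale_less[OF rq r1, of k] r0 by (simp add: field_simps)
    finally have "c * T p $ k < c * (r * T q $ k)" using cd by simp
    also have "\<dots> \<le> d * (r * T q $ k)"
      using cd r0 pos[OF q(1), of k] by (intro mult_right_mono) auto
    also have "\<dots> = r * (d *\<^sub>R T q) $ k" by simp
    also have "\<dots> = p $ k" unfolding q(2)[symmetric] using qp[of k] by (simp add: r_def)
    also have "\<dots> = c * T p $ k" using p(2) by (metis vector_scaleR_component real_scaleR_def)
    finally show False by simp
  qed
  then have "r * q $ i \<le> q $ i" for i using qp[of i] by simp
  then show ?thesis using k unfolding less_eq_vec_def r_def by (meson order_trans)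
qed

text \<open>The comparison \<open>p \<le> q\<close> alone gives no strict inequality of norms.
  Inserting it into \<open>T\<close> once more gives
  \<open>p = c T(p) \<le> c T(q) = (c / d) q\<close>, and the factor \<open>c / d < 1\<close> makes
  the inequality strict.\<close>

lemma solution_norm_less:
  assumes \<nu>: "monotone_norm \<nu>"
    and p: "0 \<le> p" "p = c *\<^sub>R T p" and q: "0 \<le> q" "q = d *\<^sub>R T q" and cd: "0 < c" "c < d"
  shows "\<nu> p < \<nu> q"
proof -
  have n: "is_norm \<nu>" using \<nu> by (simp add: monotone_norm_def)
  have d: "0 < d" using cd by simp
  have "p = c *\<^sub>R T p" by (rule p(2))
  also have "\<dots> \<le> c *\<^sub>R T q"
    using mono[OF p(1) solution_mono[OF p q cd(1)]] cd by (simp add: less_eq_vec_def)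
  also have "\<dots> = (c / d) *\<^sub>R (d *\<^sub>R T q)" using d by simp
  also have "\<dots> = (c / d) *\<^sub>R q" by (simp only: q(2)[symmetric])
  finally have "p \<le> (c / d) *\<^sub>R q" .
  moreover have "0 \<le> (c / d) *\<^sub>R q" using q(1) cd by (simp add: less_eq_vec_def)
  ultimately have "\<nu> p \<le> \<nu> ((c / d) *\<^sub>R q)"
    using \<nu> p(1) by (simp add: monotone_norm_def)
  also have "\<dots> = c / d * \<nu> q" using cd by (simp add: is_norm_scaleR[OF n])
  also have "\<dots> < \<nu> q"
  proof -
    have "q \<noteq> 0" using solution_pos[OF q(1) d q(2)] by (metis less_irrefl zero_index)
    then have "0 < \<nu> q" by (rule is_norm_pos[OF n])
    then show ?thesis using cd d by (simp add: pos_divide_less_eq)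
  qed
  finally show ?thesis .
qed

text \<open>Rescaling \<open>T x\<close> to norm \<open>b\<close> maps the nonnegative part of the
  norm ball continuously into itself. A Brouwer fixed point \<open>p\<close> solves the equation
  with \<open>c = b / \<nu> (T p)\<close>.\<close>

lemma solution_exists:
  assumes \<nu>: "is_norm \<nu>" and cont: "continuous_on {0..} T" and b: "0 < b"
  obtains p c where "0 \<le> p" "0 < c" "p = c *\<^sub>R T p" "\<nu> p = b"
proof -
  let ?S = "{x. 0 \<le> x \<and> \<nu> x \<le> b}"
  define f where "f x = (b / \<nu> (T x)) *\<^sub>R T x" for x
  have \<nu>T: "0 < \<nu> (T x)" if "0 \<le> x" for x
    by (intro is_norm_pos[OF \<nu>] nonzero that)
  have f: "0 \<le> f x" "\<nu> (f x) = b" if "0 \<le> x" for x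
    using nonneg[OF that] \<nu>T[OF that] b
    by (auto simp: f_def is_norm_scaleR[OF \<nu>] less_eq_vec_def)
  have contS: "continuous_on ?S T" by (rule continuous_on_subset[OF cont]) auto
  have "continuous_on ?S (\<lambda>x. \<nu> (T x))"
    by (rule continuous_on_compose2[OF continuous_on_is_norm[OF \<nu>, of UNIV] contS]) auto
  moreover have "\<nu> (T x) \<noteq> 0" if "x \<in> ?S" for x using \<nu>T that by force
  ultimately have "continuous_on ?S f"
    unfolding f_def by (intro continuous_intros contS) auto
  moreover have "0 \<in> ?S" using b by (simp add: is_norm_zero[OF \<nu>])
  then have "?S \<noteq> {}" by blast
  moreover have "f \<in> ?S \<rightarrow> ?S" using f by auto
  ultimately obtain p where p: "p \<in> ?S" "f p = p"
    using brouwer[OF compact_nonneg_norm_ball[OF \<nu>] convex_nonneg_norm_ball[OF \<nu>]] by blast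
  show thesis
  proof
    show "0 \<le> p" using p by simp
    then show "0 < b / \<nu> (T p)" "\<nu> p = b"
      using \<nu>T[of p] b f(2)[of p] by (simp_all add: p(2))
    show "p = (b / \<nu> (T p)) *\<^sub>R T p" using p(2) by (simp add: f_def)
  qed
qed

text \<open>A solution with a larger factor than \<open>c\<close> has norm above \<open>b\<close> by
  \<open>solution_norm_less\<close>, so it is infeasible. Any other maximiser shares
  \<open>c\<close>, and \<open>solution_mono\<close> in both directions identifies the
  vectors.\<close>

lemma optimal_pair_eq:
  assumes \<nu>: "monotone_norm \<nu>" and pc: "0 \<le> p" "0 < c" "p = c *\<^sub>R T p" "\<nu> p = b"
  shows "optimal_pair T \<nu> b = (p, c)"
  unfolding optimal_pair_def
proof (rule the_equality)
  have max: "\<not> c < d" if "feasible_pair T \<nu> b (q, d)" for q d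
    using that solution_norm_less[OF \<nu> pc(1,3) _ _ pc(2), of q d] pc(4)
    by (auto simp: feasible_pair_def)
  have feas: "feasible_pair T \<nu> b (p, c)"
    using pc by (simp add: feasible_pair_def)
  show "is_arg_max snd (feasible_pair T \<nu> b) (p, c)"
    using feas max by (auto simp: is_arg_max_def)
  fix qd assume a: "is_arg_max snd (feasible_pair T \<nu> b) qd"
  obtain q d where qd: "qd = (q, d)" by fastforce
  have q: "feasible_pair T \<nu> b (q, d)" "\<not> d < c"
    using a feas unfolding qd is_arg_max_def by (metis snd_conv)+
  then have "d = c" using max[OF q(1)] by simp
  then have "q = p"
    using q(1) pc solution_mono[of p c q c] solution_mono[of q c p c]
    by (auto simp: feasible_pair_def intro: antisym)
  then show "qd = (p, c)" using qd \<open>d = c\<close> by simp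
qed

lemma optimal_pair_solution:
  assumes \<nu>: "monotone_norm \<nu>" and cont: "continuous_on {0..} T" and b: "0 < b"
  obtains p c where "optimal_pair T \<nu> b = (p, c)" "0 \<le> p" "0 < c" "p = c *\<^sub>R T p" "\<nu> p = b"
proof -
  have "is_norm \<nu>" using \<nu> by (simp add: monotone_norm_def)
  then obtain p c where "0 \<le> p" "0 < c" "p = c *\<^sub>R T p" "\<nu> p = b"
    using solution_exists[OF _ cont b] by blast
  then show thesis using optimal_pair_eq[OF \<nu>] that by blast
qed

section \<open>The energy efficiency as a function of the budget\<close>

text \<open>The factor \<open>c\<close> of \<open>p = c T(p)\<close> cancels, so monotonicity and
  growth of the efficiency reduce to those of \<open>\<nu>b (T p)\<close>.\<close>

lemma energy_efficiency_eq:
  assumes \<nu>b: "is_norm \<nu>b"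
    and opt: "optimal_pair T \<nu>a b = (p, c)" and pc: "0 < c" "p = c *\<^sub>R T p"
  shows "energy_efficiency T \<nu>a \<nu>b b = 1 / \<nu>b (T p)"
proof -
  have "\<nu>b p = c * \<nu>b (T p)"
    using is_norm_scaleR[OF \<nu>b, of c "T p"] pc by simp
  then show ?thesis
    using opt pc(1) by (simp add: energy_efficiency_def utility_function_def power_function_def)
qed

lemma energy_efficiency_pos:
  assumes \<nu>: "monotone_norm \<nu>a" "is_norm \<nu>b" and cont: "continuous_on {0..} T" and b: "0 < b"
  shows "0 < energy_efficiency T \<nu>a \<nu>b b"
proof -
  obtain p c where pc: "optimal_pair T \<nu>a b = (p, c)" "0 \<le> p" "0 < c" "p = c *\<^sub>R T p"
    using optimal_pair_solution[OF \<nu>(1) cont b] by blast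
  show ?thesis
    unfolding energy_efficiency_eq[OF \<nu>(2) pc(1,3,4)]
    using is_norm_pos[OF \<nu>(2) nonzero[OF pc(2)]] by simp
qed

text \<open>If the larger budget had the smaller utility, \<open>solution_norm_less\<close> would
  reverse the order of the budgets. So utility grows, then \<open>p\<close> by
  \<open>solution_mono\<close>, then \<open>T p\<close> by \<open>mono\<close>, and the efficiency
  is the reciprocal of its norm.\<close>

lemma energy_efficiency_antimono:
  assumes \<nu>: "monotone_norm \<nu>a" "monotone_norm \<nu>b" and cont: "continuous_on {0..} T"
    and b: "0 < b" "b \<le> b'"
  shows "energy_efficiency T \<nu>a \<nu>b b' \<le> energy_efficiency T \<nu>a \<nu>b b"
proof -
  have nb: "is_norm \<nu>b" using \<nu>(2) by (simp add: monotone_norm_def)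
  obtain p c where pc: "optimal_pair T \<nu>a b = (p, c)" "0 \<le> p" "0 < c" "p = c *\<^sub>R T p" "\<nu>a p = b"
    using optimal_pair_solution[OF \<nu>(1) cont b(1)] by blast
  have b': "0 < b'" using b by simp
  obtain q d where qd: "optimal_pair T \<nu>a b' = (q, d)" "0 \<le> q" "0 < d" "q = d *\<^sub>R T q" "\<nu>a q = b'"
    using optimal_pair_solution[OF \<nu>(1) cont b'] by blast
  have "c \<le> d"
    using solution_norm_less[OF \<nu>(1) qd(2,4) pc(2,4) qd(3)] pc(5) qd(5) b by force
  then have "T p \<le> T q" by (intro mono solution_mono[OF pc(2,4) qd(2,4) pc(3)] pc)
  then have "\<nu>b (T p) \<le> \<nu>b (T q)"
    using \<nu>(2) nonneg pc(2) qd(2) by (simp add: monotone_norm_def)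
  moreover have "0 < \<nu>b (T p)" using is_norm_pos[OF nb nonzero[OF pc(2)]] .
  ultimately show ?thesis
    unfolding energy_efficiency_eq[OF nb pc(1,3,4)] energy_efficiency_eq[OF nb qd(1,3,4)]
    by (simp add: frac_le)
qed

text \<open>On the nonnegative part of the unit ball, \<open>K\<close> is a maximum. Outside it,
  with \<open>s = \<nu>a x\<close>, subhomogeneity gives \<open>T x \<le> s T(x / s)\<close> with
  \<open>x / s\<close> on the unit sphere, hence the bound \<open>s * K\<close>. The affine form
  covers both cases.\<close>

lemma norm_affine_bound:
  assumes \<nu>: "is_norm \<nu>a" "monotone_norm \<nu>b" and cont: "continuous_on {0..} T"
  obtains K where "0 < K" "\<And>x. 0 \<le> x \<Longrightarrow> \<nu>b (T x) \<le> K * \<nu>a x + K"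
proof -
  have nb: "is_norm \<nu>b" using \<nu>(2) by (simp add: monotone_norm_def)
  let ?S = "{x. 0 \<le> x \<and> \<nu>a x \<le> 1}"
  have contS: "continuous_on ?S T" by (rule continuous_on_subset[OF cont]) auto
  have "continuous_on ?S (\<lambda>x. \<nu>b (T x))"
    by (rule continuous_on_compose2[OF continuous_on_is_norm[OF nb, of UNIV] contS]) auto
  moreover have "0 \<in> ?S" by (simp add: is_norm_zero[OF \<nu>(1)])
  then have "?S \<noteq> {}" by blast
  ultimately have "\<exists>m\<in>?S. \<forall>x\<in>?S. \<nu>b (T x) \<le> \<nu>b (T m)"
    by (intro continuous_attains_sup[OF compact_nonneg_norm_ball[OF \<nu>(1)]])
  then obtain m where m: "m \<in> ?S" "\<And>x. x \<in> ?S \<Longrightarrow> \<nu>b (T x) \<le> \<nu>b (T m)" by blast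
  define K where "K = \<nu>b (T m)"
  have K: "0 < K" unfolding K_def using m by (intro is_norm_pos[OF nb] nonzero) simp
  show thesis
  proof
    show "0 < K" by (rule K)
    fix x :: "real ^ 'n" assume x: "0 \<le> x"
    show "\<nu>b (T x) \<le> K * \<nu>a x + K"
    proof (cases "\<nu>a x \<le> 1")
      case True
      then have "\<nu>b (T x) \<le> K" using m x by (simp add: K_def)
      then show ?thesis using K is_norm_nonneg[OF \<nu>(1), of x] by (simp add: add_increasing)
    next
      case False
      define s where "s = \<nu>a x"
      have s: "1 < s" using False by (simp add: s_def)
      define y where "y = (1 / s) *\<^sub>R x"
      have y: "0 \<le> y" "\<nu>a y = 1"
        using x s by (auto simp: y_def less_eq_vec_def is_norm_scaleR[OF \<nu>(1)]) (simp add: s_def)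
      have "T x \<le> s *\<^sub>R T y"
        unfolding less_eq_vec_def
        using scale_le[OF x, of "1 / s"] s by (simp add: y_def field_simps)
      moreover have "0 \<le> s *\<^sub>R T y" using nonneg[OF y(1)] s by (simp add: less_eq_vec_def)
      ultimately have "\<nu>b (T x) \<le> \<nu>b (s *\<^sub>R T y)"
        using \<nu>(2) nonneg[OF x] by (simp add: monotone_norm_def)
      also have "\<dots> = s * \<nu>b (T y)" using s by (simp add: is_norm_scaleR[OF nb])
      also have "\<dots> \<le> s * K" using s y m(2)[of y] by (intro mult_left_mono) (auto simp: K_def)
      finally show ?thesis using K by (simp add: s_def mult.commute)
    qed
  qed
qed

section \<open>The lower bounding matrix and the two-sided growth bounds\<close>

text \<open>Subhomogeneity makes the expression under the limit nondecreasing in \<open>h\<close>,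
  so its right limit at 0 is its infimum over all positive \<open>h\<close>.\<close>

lemma lower_bounding_matrix_bounds:
  shows "0 \<le> lower_bounding_matrix T $ i $ j"
    and "0 < h \<Longrightarrow> lower_bounding_matrix T $ i $ j \<le> h * T (inverse h *\<^sub>R axis j 1) $ i"
proof -
  define g where "g h = h * T (inverse h *\<^sub>R axis j 1) $ i" for h
  have ax: "0 \<le> inverse h *\<^sub>R (axis j 1 :: real ^ 'n)" if "0 < h" for h
    using that by (simp add: less_eq_vec_def axis_def)
  have g0: "0 \<le> g h" if "0 < h" for h
    using pos[OF ax[OF that], of i] that by (simp add: g_def)
  have gm: "g h \<le> g h'" if "0 < h" "h \<le> h'" for h h'
    using scale_le[OF ax[OF that(1)], of "h / h'" i] that by (simp add: g_def field_simps)
  have "(g \<longlongrightarrow> Inf (g ` ({0<..} \<inter> UNIV))) (at 0 within ({0<..} \<inter> UNIV))"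
    by (rule Lim_right_bound[where K = 0]) (use g0 gm in auto)
  then have "Lim (at_right 0) g = Inf (g ` {0<..})" by (intro tendsto_Lim) auto
  then have M: "lower_bounding_matrix T $ i $ j = Inf (g ` {0<..})"
    by (simp add: lower_bounding_matrix_def g_def[abs_def])
  show "0 \<le> lower_bounding_matrix T $ i $ j"
    unfolding M by (rule cINF_greatest) (auto intro: g0)
  show "lower_bounding_matrix T $ i $ j \<le> h * T (inverse h *\<^sub>R axis j 1) $ i" if "0 < h"
    unfolding M g_def[symmetric] using that g0
    by (intro cINF_lower) (auto simp: bdd_below_def intro!: exI[of _ 0])
qed

text \<open>Jensen's inequality for the equal-weight combination of the vectors \<open>N x j e j\<close>, where
  \<open>N\<close> is the dimension.\<close>

lemma lower_bounding_matrix_le: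
  assumes x: "0 \<le> x"
  shows "(lower_bounding_matrix T *v x) $ i \<le> T x $ i"
proof -
  define N where "N = real CARD('n)"
  have N: "0 < N" by (simp add: N_def)
  define y where "y j = (N * x $ j) *\<^sub>R (axis j 1 :: real ^ 'n)" for j
  have y0: "0 \<le> y j" for j using x N by (simp add: y_def less_eq_vec_def axis_def)
  have xy: "(\<Sum>j\<in>UNIV. (1 / N) *\<^sub>R y j) = x"
    using N by (simp add: y_def vec_eq_iff axis_def if_distrib[of "\<lambda>z. _ * z"] cong: if_cong)
  have cc: "concave_on {0..} (\<lambda>x. T x $ i)"
    unfolding concave_on_def
  proof (rule convex_onI)
    fix t :: real and u v :: "real ^ 'n" assume "0 < t" "t < 1" "u \<in> {0..}" "v \<in> {0..}"
    then show "- T ((1 - t) *\<^sub>R u + t *\<^sub>R v) $ i \<le> (1 - t) * - T u $ i + t * - T v $ i"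
      using concaveD[of u v "1 - t" i] by simp
  qed (auto simp: convex_def less_eq_vec_def)
  have "lower_bounding_matrix T $ i $ j * x $ j \<le> 1 / N * T (y j) $ i" for j
  proof (cases "x $ j = 0")
    case True
    then show ?thesis using pos[OF y0[of j], of i] N by simp
  next
    case False
    \<comment> \<open>For \<open>h = 1 / (N * x $ j)\<close> the argument of \<open>T\<close> in the
      entry bound is exactly \<open>y j\<close>. This choice of \<open>h\<close> requires a positive
      \<open>x $ j\<close>, whence the case split.\<close>
    then have xj: "0 < N * x $ j" using x N by (simp add: less_eq_vec_def order.strict_iff_order)
    then have "lower_bounding_matrix T $ i $ j \<le> inverse (N * x $ j) * T (y j) $ i"
      using lower_bounding_matrix_bounds(2)[of "inverse (N * x $ j)" i j]
      by (simp add: y_def del: inverse_mult_distrib)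
    then show ?thesis using xj False N by (simp add: field_simps zero_less_mult_iff)
  qed
  then have "(lower_bounding_matrix T *v x) $ i \<le> (\<Sum>j\<in>UNIV. 1 / N * T (y j) $ i)"
    by (simp add: matrix_vector_mult_def sum_mono)
  also have "\<dots> \<le> T (\<Sum>j\<in>UNIV. (1 / N) *\<^sub>R y j) $ i"
    by (rule concave_on_sum[OF _ _ cc]) (use N y0 in \<open>auto simp: N_def\<close>)
  finally show ?thesis by (simp only: xy)
qed

text \<open>With \<open>M\<close> the lower bounding matrix, \<open>M p \<le> T(p) = p / c\<close>
  and \<open>p\<close> is positive, so \<open>spectral_radius_le\<close> applies with
  \<open>r = 1 / c\<close>.\<close>

lemma solution_spectral_radius:
  assumes p: "0 \<le> p" "0 < c" "p = c *\<^sub>R T p"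
  shows "matrix_spectral_radius (lower_bounding_matrix T) \<le> 1 / c"
proof (rule spectral_radius_le)
  show "0 \<le> lower_bounding_matrix T $ i $ j" for i j by (rule lower_bounding_matrix_bounds)
  show "0 < p $ i" for i by (rule solution_pos[OF p])
  show "(lower_bounding_matrix T *v p) $ i \<le> 1 / c * p $ i" for i
  proof -
    have "p $ i = c * T p $ i" using p(3) by (metis vector_scaleR_component real_scaleR_def)
    then show ?thesis using lower_bounding_matrix_le[OF p(1), of i] p(2) by simp
  qed
qed

text \<open>Reciprocal of the affine bound at the optimal \<open>p\<close>, whose
  \<open>\<nu>a\<close>-norm is exactly \<open>b\<close>.\<close>

lemma energy_efficiency_lower:
  assumes \<nu>: "monotone_norm \<nu>a" "monotone_norm \<nu>b" and cont: "continuous_on {0..} T"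
  obtains K where "0 < K" "\<And>b. 0 < b \<Longrightarrow> 1 / (K * b + K) \<le> energy_efficiency T \<nu>a \<nu>b b"
proof -
  have n: "is_norm \<nu>a" "is_norm \<nu>b" using \<nu> by (simp_all add: monotone_norm_def)
  obtain K where K: "0 < K" "\<And>x. 0 \<le> x \<Longrightarrow> \<nu>b (T x) \<le> K * \<nu>a x + K"
    using norm_affine_bound[OF n(1) \<nu>(2) cont] by blast
  show thesis
  proof
    show "0 < K" by (rule K)
    fix b :: real assume b: "0 < b"
    obtain p c where pc: "optimal_pair T \<nu>a b = (p, c)" "0 \<le> p" "0 < c" "p = c *\<^sub>R T p" "\<nu>a p = b"
      using optimal_pair_solution[OF \<nu>(1) cont b] by blast
    show "1 / (K * b + K) \<le> energy_efficiency T \<nu>a \<nu>b b"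
      unfolding energy_efficiency_eq[OF n(2) pc(1,3,4)]
      using K(2)[OF pc(2)] pc(5) is_norm_pos[OF n(2) nonzero[OF pc(2)]] by (simp add: frac_le)
  qed
qed

lemma energy_efficiency_upper:
  assumes \<nu>: "monotone_norm \<nu>a" "is_norm \<nu>b" and cont: "continuous_on {0..} T"
    and \<rho>: "0 < matrix_spectral_radius (lower_bounding_matrix T)"
  obtains K where "0 < K" "\<And>b. 0 < b \<Longrightarrow> energy_efficiency T \<nu>a \<nu>b b \<le> K / b"
proof -
  let ?\<rho> = "matrix_spectral_radius (lower_bounding_matrix T)"
  have n: "is_norm \<nu>a" using \<nu> by (simp add: monotone_norm_def)
  obtain m where m: "0 < m" "\<And>x. m * \<nu>a x \<le> \<nu>b x" using is_norm_equivalent[OF n \<nu>(2)] by blast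
  show thesis
  proof
    \<comment> \<open>The constant combines \<open>c \<le> 1 / ?\<rho>\<close> in the numerator with
      \<open>\<nu>b p \<ge> m * \<nu>a p = m * b\<close> in the denominator.\<close>
    show "0 < 1 / (m * ?\<rho>)" using m \<rho> by simp
    fix b :: real assume b: "0 < b"
    obtain p c where pc: "optimal_pair T \<nu>a b = (p, c)" "0 \<le> p" "0 < c" "p = c *\<^sub>R T p" "\<nu>a p = b"
      using optimal_pair_solution[OF \<nu>(1) cont b] by blast
    have "m * b \<le> \<nu>b p" using m(2)[of p] pc(5) by simp
    moreover have "0 < m * b" using m b by simp
    moreover have "c \<le> 1 / ?\<rho>"
      using solution_spectral_radius[OF pc(2,3,4)] pc(3) \<rho> by (simp add: field_simps)
    ultimately have "c / \<nu>b p \<le> (1 / ?\<rho>) / (m * b)" using pc(3) \<rho> by (intro frac_le) auto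
    then show "energy_efficiency T \<nu>a \<nu>b b \<le> 1 / (m * ?\<rho>) / b"
      using pc(1)
      by (simp add: energy_efficiency_def utility_function_def power_function_def mult_ac)
  qed
qed

end

section \<open>The limit at infinity and the assembly of the three claims\<close>

text \<open>A nonincreasing function bounded below tends to its infimum. Taking the infimum in
  \<open>ereal\<close> makes its finiteness part of the claim; the lower bound 0 transfers it to the
  reals.\<close>

lemma antimono_tendsto_at_top_INF:
  fixes f :: "real \<Rightarrow> real"
  assumes nonneg: "\<And>x. 0 < x \<Longrightarrow> 0 \<le> f x"
    and antimono: "\<And>x y. 0 < x \<Longrightarrow> x \<le> y \<Longrightarrow> f y \<le> f x"
  shows "(f \<longlongrightarrow> (INF x\<in>{0<..}. f x)) at_top"
    and "(INF x\<in>{0<..}. ereal (f x)) = ereal (INF x\<in>{0<..}. f x)"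
proof -
  have bdd: "bdd_below (f ` {0<..})" using nonneg by (auto simp: bdd_below_def intro!: exI[of _ 0])
  show "(f \<longlongrightarrow> (INF x\<in>{0<..}. f x)) at_top"
  proof (rule decreasing_tendsto)
    show "\<forall>\<^sub>F x in at_top. (INF x\<in>{0<..}. f x) \<le> f x"
      using eventually_gt_at_top[of 0] by eventually_elim (use bdd in \<open>auto intro: cINF_lower\<close>)
    fix a assume "(INF x\<in>{0<..}. f x) < a"
    then obtain y where y: "0 < y" "f y < a" using bdd by (auto simp: cINF_less_iff)
    show "\<forall>\<^sub>F x in at_top. f x < a"
      using eventually_ge_at_top[of y] by eventually_elim (use y antimono in force)
  qed
  show "(INF x\<in>{0<..}. ereal (f x)) = ereal (INF x\<in>{0<..}. f x)"
    using ereal_Inf'[OF bdd] by (simp add: image_comp)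
qed

theorem corollary2:
  fixes T :: "real ^ 'n \<Rightarrow> real ^ 'n"
    and norm_a norm_b :: "real ^ 'n \<Rightarrow> real"
    and M :: "real ^ 'n ^ 'n"
    and E :: "real \<Rightarrow> real"
  assumes T_pos: "\<And>x i. x \<ge> 0 \<Longrightarrow> T x $ i > 0"
    and T_cont: "continuous_on {0..} T"
    and T_concave: "concave_map T"
    and M_eq: "M = lower_bounding_matrix T"
    and norm_a: "monotone_norm norm_a"
    and norm_b: "monotone_norm norm_b"
    and E_eq: "E = energy_efficiency T norm_a norm_b"
  shows "((\<exists>L :: real. (E \<longlongrightarrow> L) at_top \<and> (INF p\<in>{0<..}. ereal (E p)) = ereal L)
          \<and> (matrix_spectral_radius M > 0 \<longrightarrow> (E \<longlongrightarrow> 0) at_top))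
    \<and> (matrix_spectral_radius M > 0 \<longrightarrow>
          (\<exists>k1>0. \<exists>k2>0. \<forall>p>0. 1 / (k1 * p + k2) \<le> E p))
    \<and> (matrix_spectral_radius M > 0 \<longrightarrow> E \<in> theta_at_infinity (\<lambda>p. 1 / p))"
proof -
  interpret positive_concave_map T by unfold_locales (fact T_pos T_concave)+
  have n: "is_norm norm_b" using norm_b by (simp add: monotone_norm_def)
  have E_pos: "0 < E b" if "0 < b" for b
    unfolding E_eq by (rule energy_efficiency_pos[OF norm_a n T_cont that])
  have "E y \<le> E x" if "0 < x" "x \<le> y" for x y
    unfolding E_eq by (rule energy_efficiency_antimono[OF norm_a norm_b T_cont that])
  then have limit: "\<exists>L. (E \<longlongrightarrow> L) at_top \<and> (INF p\<in>{0<..}. ereal (E p)) = ereal L"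
    using antimono_tendsto_at_top_INF[of E] E_pos by (meson less_imp_le)
  obtain K where K: "0 < K" "\<And>b. 0 < b \<Longrightarrow> 1 / (K * b + K) \<le> E b"
    using energy_efficiency_lower[OF norm_a norm_b T_cont] unfolding E_eq by blast
  have zero: "(E \<longlongrightarrow> 0) at_top" and theta: "E \<in> theta_at_infinity (\<lambda>p. 1 / p)"
    if rho: "matrix_spectral_radius M > 0"
  proof -
    obtain C where C: "0 < C" "\<And>b. 0 < b \<Longrightarrow> E b \<le> C / b"
      using energy_efficiency_upper[OF norm_a n T_cont] rho unfolding E_eq M_eq by blast
    have "((\<lambda>b. C / b) \<longlongrightarrow> 0) at_top"
      by (intro tendsto_divide_0[OF tendsto_const] filterlim_at_top_imp_at_infinity filterlim_ident)
    moreover have "\<forall>\<^sub>F b in at_top. 0 \<le> E b"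
      using eventually_gt_at_top[of 0] by eventually_elim (rule less_imp_le[OF E_pos])
    moreover have "\<forall>\<^sub>F b in at_top. E b \<le> C / b"
      using eventually_gt_at_top[of 0] by eventually_elim (rule C(2))
    ultimately show "(E \<longlongrightarrow> 0) at_top"
      using tendsto_sandwich[OF _ _ tendsto_const] by blast
    \<comment> \<open>For \<open>b \<ge> 1\<close> one has \<open>K * b + K \<le> 2 * K * b\<close>,
      which fixes the threshold 1 and the lower constant \<open>1 / (2 * K)\<close>.\<close>
    have "1 / (2 * K) * (1 / b) \<le> E b \<and> E b \<le> C * (1 / b)" if "1 \<le> b" for b
    proof
      have b: "0 < b" using that by simp
      have "1 / (2 * K) * (1 / b) = 1 / (2 * K * b)" by simp
      also have "\<dots> \<le> 1 / (K * b + K)" using that b K(1) by (intro frac_le) (auto simp: add_pos_pos)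
      also have "\<dots> \<le> E b" by (rule K(2)[OF b])
      finally show "1 / (2 * K) * (1 / b) \<le> E b" .
      show "E b \<le> C * (1 / b)" using C(2)[OF b] by simp
    qed
    moreover have "0 < 1 / (2 * K)" using K by simp
    ultimately show "E \<in> theta_at_infinity (\<lambda>p. 1 / p)"
      unfolding theta_at_infinity_def using C(1) zero_less_one by blast
  qed
  \<comment> \<open>In claim (ii) the single constant \<open>K\<close> serves as both
    \<open>k1\<close> and \<open>k2\<close>.\<close>
  show ?thesis using limit zero theta K by blast
qed

end
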